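(* Let $(X_n,M_n)_{n\ge0}$ be the $\{-1,1\}\times\mathbb{N}^*$-valued Markov chain described in the context, with $(X_0,M_0)=(1,1)$, and let $S_n=\sum_{k=0}^nX_k$. (i) Let $L_n(1)=\sum_{k=1}^n\mathbf 1_{\{X_k=1\}}$. Then for $n\ge1$, $S_n=1+2L_n(1)-n$. Consequently, for any $0\le k\le n$, $$\eta_n(k):=\mathbb{P}(S_n=1+2k-n)=\mathbb{P}(L_n(1)=k).$$ (ii) Moreover, for $0\le k\le n$, $\eta_n(k)=\eta_n^{(1)}(k)+\eta_n^{(2)}(k)$ with $$\eta_n^{(1)}(k)=\sum_{1\le m\le(k+1)\wedge(n-k)}A_2(m,k+1)\sum_{\ell=1}^{n-k-m+1}A_1(m-1,n-k-\ell)\,\mathcal{P}_1(\ell),$$ $$\eta_n^{(2)}(k)=\sum_{0\le m\le k\wedge(n-k)}A_1(m,n-k)\sum_{\ell=1}^{k-m+1}A_2(m,k+1-\ell)\,\mathcal{P}_2(\ell).$$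
   Context: $\mathbb{N}^*=\{1,2,\ldots\}$; $a_1=-1$, $a_2=1$; $\alpha_{i,n}\in(0,1)$ for $i=1,2$, $n\ge1$. The chain $(X_n,M_n)$ goes from $(a_i,n)$ to $(a_i,n+1)$ with probability $1-\alpha_{i,n}$ and to $(a_j,1)$, $j\ne i$, with probability $\alpha_{i,n}$. $\mathcal{P}_i(m)=\prod_{k=1}^{m-1}(1-\alpha_{i,k})$ for $m\ge1$ (empty product $=1$). For $m,b\ge1$, $\mathcal{N}(m,b)=\{u\in(\mathbb{N}^* )^m:u_1+\cdots+u_m=b\}$ and $$A_i(m,b)=\sum_{u\in\mathcal{N}(m,b)}\mathcal{P}_i(u_1)\cdots\mathcal{P}_i(u_m)\,\alpha_{i,u_1}\cdots\alpha_{i,u_m},\quad i=1,2,$$ with the conventions $A_i(m,b)=0$ for $0\le b<m$ and $A_i(0,b)=\mathbf 1_{\{b=0\}}$. Here $x\wedge y=\min(x,y)$. *)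

theory Defs
  imports "HOL-Probability.Probability"
begin

text \<open>
  Time-homogeneous Markov chain with countable state space \<open>E\<close> and transition probabilities \<open>p\<close>,
  on an arbitrary probability space \<open>\<Omega>\<close>. The initial law is left free. Measurability into
  \<open>count_space E\<close> also says that \<open>Z n\<close> maps \<open>space \<Omega>\<close> into \<open>E\<close>.
\<close>
definition markov_chain ::
  "'w measure \<Rightarrow> 's set \<Rightarrow> ('s \<Rightarrow> 's \<Rightarrow> real) \<Rightarrow> (nat \<Rightarrow> 'w \<Rightarrow> 's) \<Rightarrow> bool" where
  "markov_chain \<Omega> E p Z \<longleftrightarrow>
     prob_space \<Omega> \<and> countable E \<and>
     (\<forall>n. Z n \<in> measurable \<Omega> (count_space E)) \<and>
     (\<forall>n. \<forall>h. \<forall>y\<in>E. (\<forall>i\<le>n. h i \<in> E) \<longrightarrow>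
        \<P>(\<omega> in \<Omega>. \<forall>i\<le>n. Z i \<omega> = h i) > 0 \<longrightarrow>
        \<P>(\<omega> in \<Omega>. Z (Suc n) \<omega> = y \<bar> \<forall>i\<le>n. Z i \<omega> = h i) = p (h n) y)"

text \<open>
  The letters are \<open>a\<^sub>1 = -1\<close> and \<open>a\<^sub>2 = 1\<close>, so that \<open>a\<^sub>j = - a\<^sub>i\<close> for \<open>j \<noteq> i\<close>;
  \<open>letter_index\<close> recovers \<open>i\<close> from \<open>a\<^sub>i\<close>. In \<open>\<alpha> i n\<close> only \<open>i \<in> {1, 2}\<close> and \<open>n \<ge> 1\<close> matter.
\<close>
definition letter_index :: "int \<Rightarrow> nat" where
  "letter_index x = (if x = -1 then 1 else 2)"

definition states :: "(int \<times> nat) set" where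
  "states = {-1, 1} \<times> {1..}"

fun trans_prob :: "(nat \<Rightarrow> nat \<Rightarrow> real) \<Rightarrow> int \<times> nat \<Rightarrow> int \<times> nat \<Rightarrow> real" where
  "trans_prob \<alpha> (x, n) (y, l) =
     (if y = x \<and> l = n + 1 then 1 - \<alpha> (letter_index x) n
      else if y = - x \<and> l = 1 then \<alpha> (letter_index x) n
      else 0)"

definition surv :: "(nat \<Rightarrow> nat \<Rightarrow> real) \<Rightarrow> nat \<Rightarrow> nat \<Rightarrow> real" where
  "surv \<alpha> i m = (\<Prod>k\<in>{1..<m}. 1 - \<alpha> i k)"

definition compositions :: "nat \<Rightarrow> nat \<Rightarrow> nat list set" where
  "compositions m b = {u. length u = m \<and> (\<forall>x\<in>set u. 1 \<le> x) \<and> sum_list u = b}"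

lemma finite_compositions: "finite (compositions m b)"
proof (rule finite_subset)
  show "compositions m b \<subseteq> {u. set u \<subseteq> {..b} \<and> length u = m}"
    by (auto simp: compositions_def member_le_sum_list)
  show "finite {u. set u \<subseteq> {..b} \<and> length u = m}"
    by (rule finite_lists_length_eq) simp
qed

definition A :: "(nat \<Rightarrow> nat \<Rightarrow> real) \<Rightarrow> nat \<Rightarrow> nat \<Rightarrow> nat \<Rightarrow> real" where
  "A \<alpha> i m b =
     (if m = 0 then of_bool (b = 0)
      else if b < m then 0
      else (\<Sum>u\<in>compositions m b. (\<Prod>r<m. surv \<alpha> i (u ! r)) * (\<Prod>r<m. \<alpha> i (u ! r))))"

definition S :: "(nat \<Rightarrow> 'w \<Rightarrow> int) \<Rightarrow> nat \<Rightarrow> 'w \<Rightarrow> int" where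
  "S X n \<omega> = (\<Sum>k=0..n. X k \<omega>)"

definition L1 :: "(nat \<Rightarrow> 'w \<Rightarrow> int) \<Rightarrow> nat \<Rightarrow> 'w \<Rightarrow> nat" where
  "L1 X n \<omega> = (\<Sum>k=1..n. of_bool (X k \<omega> = 1))"

definition eta :: "'w measure \<Rightarrow> (nat \<Rightarrow> 'w \<Rightarrow> int) \<Rightarrow> nat \<Rightarrow> nat \<Rightarrow> real" where
  "eta \<Omega> X n k = \<P>(\<omega> in \<Omega>. S X n \<omega> = 1 + 2 * int k - int n)"

text \<open>
  In the next two definitions the ranges of summation ensure, for \<open>k \<le> n\<close>, that no
  subtraction of natural numbers is truncated.
\<close>
definition eta1 :: "(nat \<Rightarrow> nat \<Rightarrow> real) \<Rightarrow> nat \<Rightarrow> nat \<Rightarrow> real" where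
  "eta1 \<alpha> n k =
     (\<Sum>m = 1..min (k + 1) (n - k).
        A \<alpha> 2 m (k + 1) * (\<Sum>l = 1..n - k - m + 1. A \<alpha> 1 (m - 1) (n - k - l) * surv \<alpha> 1 l))"

definition eta2 :: "(nat \<Rightarrow> nat \<Rightarrow> real) \<Rightarrow> nat \<Rightarrow> nat \<Rightarrow> real" where
  "eta2 \<alpha> n k =
     (\<Sum>m = 0..min k (n - k).
        A \<alpha> 1 m (n - k) * (\<Sum>l = 1..k - m + 1. A \<alpha> 2 m (k + 1 - l) * surv \<alpha> 2 l))"

end

theory Submission
  imports Defs
begin

text \<open>
  The trajectory \<open>X\<^sub>0, X\<^sub>1, \<dots>\<close> is a sequence of alternating runs of \<open>1\<close> and \<open>-1\<close>, the first one
  a run of \<open>1\<close>, and \<open>M\<close> is the age of the current run. A run of letter \<open>a\<^sub>i\<close> ends with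
  length \<open>l\<close> with probability \<open>surv \<alpha> i l * \<alpha> i l\<close>, and reaches age \<open>l\<close> with probability
  \<open>surv \<alpha> i l\<close>. Hence \<open>A \<alpha> i m b\<close> is the probability that \<open>m\<close> independent complete runs of letter
  \<open>a\<^sub>i\<close> have total length \<open>b\<close>. Among \<open>X\<^sub>0, \<dots>, X\<^sub>n\<close> there are \<open>k + 1\<close> letters \<open>1\<close> and \<open>n - k\<close>
  letters \<open>-1\<close> exactly when \<open>L\<^sub>n(1) = k\<close>; the initial letter accounts for the shift by one. If
  \<open>X\<^sub>n = -1\<close>, then some number \<open>m \<ge> 1\<close> of runs of \<open>1\<close> are complete, as are \<open>m - 1\<close> runs of
  \<open>-1\<close>, and the last run has some age \<open>l\<close>; this case contributes \<open>eta1\<close>. If \<open>X\<^sub>n = 1\<close>, then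
  \<open>m \<ge> 0\<close> runs of each letter are complete; this case contributes \<open>eta2\<close>.

  The proof makes this rigorous without a decomposition of the trajectory into runs: it computes
  the joint law of \<open>L\<^sub>n(1)\<close> and \<open>(X\<^sub>n, M\<^sub>n)\<close> by induction on \<open>n\<close> (\<open>joint_law\<close>). Summing over
  \<open>m\<close> first gives the probability that a run of \<open>1\<close>, or of \<open>-1\<close>, starts after \<open>p\<close> letters \<open>1\<close>
  and \<open>q\<close> letters \<open>-1\<close>. These two functions determine each other by conditioning on the length
  of the preceding run (\<open>minus_run_start_rec\<close>, \<open>plus_run_start_rec\<close>), which is the one-step
  equation of the chain for states with \<open>M = 1\<close>; for states with \<open>M > 1\<close> the one-step equation
  is the product formula for \<open>surv\<close>. The one-step equations themselves
  (\<open>markov_chain_predecessors\<close>) extend the Markov property from single histories to events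
  of the past. It remains to sum the joint law over the current state.
\<close>

section \<open>Splitting off the first run\<close>

text \<open>
  The two degenerate clauses in the definition of \<open>A\<close> agree with the general sum: \<open>compositions 0 b\<close>
  contains at most the empty list, and \<open>compositions m b\<close> is empty for \<open>b < m\<close>. In this uniform
  form the sum can be split along the first entry of the list.
\<close>

lemma A_eq_sum_list:
  "A \<alpha> i m b = (\<Sum>u\<in>compositions m b. \<Prod>x\<leftarrow>u. surv \<alpha> i x * \<alpha> i x)"
proof -
  have comp0: "compositions 0 b = (if b = 0 then {[]} else {})"
    by (auto simp: compositions_def)
  have small: "compositions m b = {}" if "b < m"
  proof -
    have "length u \<le> sum_list u" if "\<forall>x\<in>set u. 1 \<le> x" for u :: "nat list"
      using that by (induction u) auto
    with \<open>b < m\<close> show ?thesis by (fastforce simp: compositions_def)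
  qed
  have prods: "(\<Prod>r<m. surv \<alpha> i (u ! r)) * (\<Prod>r<m. \<alpha> i (u ! r)) = (\<Prod>x\<leftarrow>u. surv \<alpha> i x * \<alpha> i x)"
    if "u \<in> compositions m b" for u
    using that
    by (auto simp: compositions_def prod.distrib[symmetric] prod.list_conv_set_nth atLeast0LessThan
        intro!: prod.cong)
  show ?thesis
    using comp0 small prods by (auto simp: A_def)
qed

lemma A_0: "A \<alpha> i 0 b = of_bool (b = 0)"
  by (simp add: A_def)

lemma A_eq_0: "b < m \<Longrightarrow> A \<alpha> i m b = 0"
  by (simp add: A_def)

text \<open>
  Condition on the length \<open>l\<close> of the first of the \<open>m + 1\<close> runs.
\<close>

lemma A_Suc:
  "A \<alpha> i (Suc m) b = (\<Sum>l=1..b. A \<alpha> i m (b - l) * (surv \<alpha> i l * \<alpha> i l))"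
proof -
  have decomp: "compositions (Suc m) b = (\<Union>l\<in>{1..b}. (#) l ` compositions m (b - l))"
    by (auto simp: compositions_def length_Suc_conv image_iff)
  have "A \<alpha> i (Suc m) b =
      (\<Sum>l=1..b. \<Sum>u\<in>(#) l ` compositions m (b - l). \<Prod>x\<leftarrow>u. surv \<alpha> i x * \<alpha> i x)"
    unfolding A_eq_sum_list decomp
    by (rule sum.UNION_disjoint) (auto simp: finite_compositions)
  also have "\<dots> = (\<Sum>l=1..b. A \<alpha> i m (b - l) * (surv \<alpha> i l * \<alpha> i l))"
    by (simp add: A_eq_sum_list sum.reindex sum_distrib_left sum_distrib_right mult_ac)
  finally show ?thesis .
qed

lemma surv_1: "surv \<alpha> i (Suc 0) = 1"
  by (simp add: surv_def)

lemma surv_Suc: "l \<ge> 1 \<Longrightarrow> surv \<alpha> i (Suc l) = surv \<alpha> i l * (1 - \<alpha> i l)"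
  by (simp add: surv_def atLeastLessThanSuc mult.commute)


section \<open>The start of a run\<close>

text \<open>
  This is the probability that, after \<open>p\<close> letters \<open>1\<close> and \<open>q\<close> letters \<open>-1\<close> in total, a new run of
  \<open>1\<close> starts. Equally many runs of both letters are then complete, and there are at most \<open>q\<close>
  of them because each run has length at least one.
\<close>

definition plus_run_start :: "(nat \<Rightarrow> nat \<Rightarrow> real) \<Rightarrow> nat \<Rightarrow> nat \<Rightarrow> real" where
  "plus_run_start \<alpha> p q = (\<Sum>m\<le>q. A \<alpha> 1 m q * A \<alpha> 2 m p)"

text \<open>
  The analogue for a new run of \<open>-1\<close>. The trajectory starts with a run of \<open>1\<close>, so one more
  run of \<open>1\<close> is complete than of \<open>-1\<close>.
\<close>

definition minus_run_start :: "(nat \<Rightarrow> nat \<Rightarrow> real) \<Rightarrow> nat \<Rightarrow> nat \<Rightarrow> real" where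
  "minus_run_start \<alpha> p q = (\<Sum>m\<le>q. A \<alpha> 1 m q * A \<alpha> 2 (Suc m) p)"

lemma plus_run_start_0_0: "plus_run_start \<alpha> 0 0 = 1"
  by (simp add: plus_run_start_def A_0)

lemma plus_run_start_0: "q > 0 \<Longrightarrow> plus_run_start \<alpha> 0 q = 0"
  unfolding plus_run_start_def
proof (intro sum.neutral ballI)
  fix m
  assume "q > 0"
  then show "A \<alpha> 1 m q * A \<alpha> 2 m 0 = 0"
    by (cases m) (simp_all add: A_0 A_eq_0)
qed

text \<open>
  A run of \<open>-1\<close> starts when a run of \<open>1\<close> ends; \<open>l\<close> is the length of the run that ends.
\<close>

lemma minus_run_start_rec:
  "minus_run_start \<alpha> p q =
     (\<Sum>l=1..p. plus_run_start \<alpha> (p - l) q * (surv \<alpha> 2 l * \<alpha> 2 l))"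
proof -
  have "minus_run_start \<alpha> p q =
      (\<Sum>m\<le>q. \<Sum>l=1..p. A \<alpha> 1 m q * A \<alpha> 2 m (p - l) * (surv \<alpha> 2 l * \<alpha> 2 l))"
    unfolding minus_run_start_def A_Suc sum_distrib_left mult.assoc ..
  also have "\<dots> = (\<Sum>l=1..p. \<Sum>m\<le>q. A \<alpha> 1 m q * A \<alpha> 2 m (p - l) * (surv \<alpha> 2 l * \<alpha> 2 l))"
    by (rule sum.swap)
  finally show ?thesis
    unfolding plus_run_start_def sum_distrib_right .
qed

text \<open>
  A run of \<open>1\<close> starts when a run of \<open>-1\<close> ends, unless it is the initial run, which has
  \<open>p = 0\<close> letters \<open>1\<close> before it.
\<close>

lemma plus_run_start_rec:
  assumes "p > 0"
  shows "plus_run_start \<alpha> p q =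
           (\<Sum>l=1..q. minus_run_start \<alpha> p (q - l) * (surv \<alpha> 1 l * \<alpha> 1 l))"
proof -
  have "plus_run_start \<alpha> p q = (\<Sum>m\<in>{..<q}. A \<alpha> 1 (Suc m) q * A \<alpha> 2 (Suc m) p)"
    using assms unfolding plus_run_start_def
    by (subst sum.atMost_shift) (simp add: A_0)
  also have "\<dots> = (\<Sum>m<q. \<Sum>l=1..q.
      A \<alpha> 1 m (q - l) * A \<alpha> 2 (Suc m) p * (surv \<alpha> 1 l * \<alpha> 1 l))"
    unfolding A_Suc[of \<alpha> 1] sum_distrib_right by (simp add: mult_ac)
  also have "\<dots> = (\<Sum>l=1..q. \<Sum>m<q.
      A \<alpha> 1 m (q - l) * A \<alpha> 2 (Suc m) p * (surv \<alpha> 1 l * \<alpha> 1 l))"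
    by (rule sum.swap)
  also have "\<dots> = (\<Sum>l=1..q. minus_run_start \<alpha> p (q - l) * (surv \<alpha> 1 l * \<alpha> 1 l))"
  proof (rule sum.cong[OF refl])
    fix l assume "l \<in> {1..q}"
    \<comment> \<open>At most \<open>q - l\<close> complete runs have total length \<open>q - l\<close>, and \<open>q - l < q\<close>.\<close>
    then have "(\<Sum>m<q. A \<alpha> 1 m (q - l) * A \<alpha> 2 (Suc m) p * (surv \<alpha> 1 l * \<alpha> 1 l)) =
        (\<Sum>m\<le>q - l. A \<alpha> 1 m (q - l) * A \<alpha> 2 (Suc m) p * (surv \<alpha> 1 l * \<alpha> 1 l))"
      by (intro sum.mono_neutral_right) (auto simp: A_eq_0)
    then show "(\<Sum>m<q. A \<alpha> 1 m (q - l) * A \<alpha> 2 (Suc m) p * (surv \<alpha> 1 l * \<alpha> 1 l)) =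
        minus_run_start \<alpha> p (q - l) * (surv \<alpha> 1 l * \<alpha> 1 l)"
      by (simp add: minus_run_start_def sum_distrib_right)
  qed
  finally show ?thesis .
qed


section \<open>One step of a Markov chain, given an event of the past\<close>

lemma measurable_history:
  assumes "\<And>i. Z i \<in> measurable \<Omega> (count_space E)" and "countable E"
  shows "(\<lambda>\<omega>. \<lambda>i\<in>{..n::nat}. Z i \<omega>) \<in> measurable \<Omega> (count_space ({..n} \<rightarrow>\<^sub>E E))"
proof -
  have space: "(\<lambda>\<omega>. \<lambda>i\<in>{..n}. Z i \<omega>) \<in> space \<Omega> \<rightarrow> ({..n} \<rightarrow>\<^sub>E E)"
    using assms(1)[THEN measurable_space] by auto
  have count: "countable ({..n} \<rightarrow>\<^sub>E E)"
    using assms(2) by (intro countable_PiE) auto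
  have "(\<lambda>\<omega>. \<lambda>i\<in>{..n}. Z i \<omega>) -` {h} \<inter> space \<Omega> \<in> sets \<Omega>" if "h \<in> {..n} \<rightarrow>\<^sub>E E" for h
  proof -
    have "(\<lambda>\<omega>. \<lambda>i\<in>{..n}. Z i \<omega>) -` {h} \<inter> space \<Omega> = (\<Inter>i\<in>{..n}. Z i -` {h i} \<inter> space \<Omega>)"
      using that by (auto simp: fun_eq_iff PiE_def extensional_def restrict_def)
    also have "\<dots> \<in> sets \<Omega>"
      using that assms(1) by (intro sets.finite_INT measurable_sets) auto
    finally show ?thesis .
  qed
  then show ?thesis
    using space count by (subst measurable_count_space_eq_countable) auto
qed

text \<open>
  The definition of a Markov chain conditions on one full history at a time. An event \<open>Q\<close> of the
  past with \<open>Z n = s\<close> is a countable disjoint union of such histories, all with the same last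
  state \<open>s\<close>, so the factor \<open>p s y\<close> is common to all of them. Histories of probability zero
  contribute zero to both sides.
\<close>

lemma markov_chain_step:
  assumes chain: "markov_chain \<Omega> E p Z" and E: "s \<in> E" "y \<in> E" and p: "p s y \<ge> 0"
  shows "\<P>(\<omega> in \<Omega>. Q (\<lambda>i\<in>{..n}. Z i \<omega>) \<and> Z (Suc n) \<omega> = y \<and> Z n \<omega> = s) =
         \<P>(\<omega> in \<Omega>. Q (\<lambda>i\<in>{..n}. Z i \<omega>) \<and> Z n \<omega> = s) * p s y"
proof -
  interpret prob_space \<Omega>
    using chain by (simp add: markov_chain_def)
  have E_count: "countable E" and Z: "\<And>i. Z i \<in> measurable \<Omega> (count_space E)"
    using chain by (auto simp: markov_chain_def)
  define H where "H = {h \<in> {..n} \<rightarrow>\<^sub>E E. Q h \<and> h n = s}"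
  define B where "B h = {\<omega> \<in> space \<Omega>. (\<lambda>i\<in>{..n}. Z i \<omega>) = h}" for h
  define Y where "Y = {\<omega> \<in> space \<Omega>. Z (Suc n) \<omega> = y}"
  have H_count: "countable H"
    unfolding H_def using E_count
    by (intro countable_subset[OF _ countable_PiE[of "{..n}" "\<lambda>_. E"]]) auto
  have B_sets: "B h \<in> sets \<Omega>" if "h \<in> H" for h
  proof -
    have "B h = (\<lambda>\<omega>. \<lambda>i\<in>{..n}. Z i \<omega>) -` {h} \<inter> space \<Omega>" by (auto simp: B_def)
    also have "\<dots> \<in> sets \<Omega>"
      using that by (intro measurable_sets[OF measurable_history[OF Z E_count]]) (auto simp: H_def)
    finally show ?thesis .
  qed
  have Y_sets: "Y \<in> sets \<Omega>"
  proof -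
    have "Y = Z (Suc n) -` {y} \<inter> space \<Omega>" by (auto simp: Y_def)
    then show ?thesis using measurable_sets[OF Z, of "{y}"] E by simp
  qed
  have step: "prob (B h \<inter> Y) = p s y * prob (B h)" if h: "h \<in> H" for h
  proof (cases "prob (B h) > 0")
    case True
    have B_eq: "B h = {\<omega> \<in> space \<Omega>. \<forall>i\<le>n. Z i \<omega> = h i}"
      using h by (auto simp: B_def H_def fun_eq_iff PiE_def extensional_def restrict_def)
    have "\<forall>i\<le>n. h i \<in> E" "h n = s" using h by (auto simp: H_def)
    with True chain E have
      "\<P>(\<omega> in \<Omega>. Z (Suc n) \<omega> = y \<bar> \<forall>i\<le>n. Z i \<omega> = h i) = p s y"
      unfolding markov_chain_def B_eq by blast
    moreover have "{\<omega> \<in> space \<Omega>. Z (Suc n) \<omega> = y \<and> (\<forall>i\<le>n. Z i \<omega> = h i)} = B h \<inter> Y"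
      by (auto simp: B_eq Y_def)
    ultimately show ?thesis
      using True by (simp add: cond_prob_def B_eq[symmetric] field_simps)
  next
    case False
    then have "prob (B h) = 0" by (simp add: zero_less_measure_iff)
    moreover have "prob (B h \<inter> Y) \<le> prob (B h)"
      by (rule finite_measure_mono) (auto simp: B_sets[OF h])
    ultimately show ?thesis by (simp add: measure_le_0_iff)
  qed
  have disj: "disjoint_family_on B H" "disjoint_family_on (\<lambda>h. B h \<inter> Y) H"
    by (auto simp: disjoint_family_on_def B_def)
  have Z_E: "Z i \<omega> \<in> E" if "\<omega> \<in> space \<Omega>" for i \<omega>
    using measurable_space[OF Z that] by simp
  have past: "{\<omega> \<in> space \<Omega>. Q (\<lambda>i\<in>{..n}. Z i \<omega>) \<and> Z n \<omega> = s} = (\<Union>h\<in>H. B h)"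
    by (auto simp: H_def B_def Z_E)
  have past_step: "{\<omega> \<in> space \<Omega>. Q (\<lambda>i\<in>{..n}. Z i \<omega>) \<and> Z (Suc n) \<omega> = y \<and> Z n \<omega> = s}
      = (\<Union>h\<in>H. B h \<inter> Y)"
    by (auto simp: H_def B_def Y_def Z_E)
  have "emeasure \<Omega> (\<Union>h\<in>H. B h \<inter> Y) =
      (\<integral>\<^sup>+h. emeasure \<Omega> (B h \<inter> Y) \<partial>count_space H)"
    using H_count disj B_sets Y_sets by (intro emeasure_UN_countable) auto
  also have "\<dots> = (\<integral>\<^sup>+h. ennreal (p s y) * emeasure \<Omega> (B h) \<partial>count_space H)"
    using p by (intro nn_integral_cong) (simp add: emeasure_eq_measure step ennreal_mult)
  also have "\<dots> = ennreal (p s y) * emeasure \<Omega> (\<Union>h\<in>H. B h)"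
    using H_count disj B_sets
    by (subst emeasure_UN_countable) (auto intro!: nn_integral_cmult)
  finally have "ennreal (prob (\<Union>h\<in>H. B h \<inter> Y)) = ennreal (p s y * prob (\<Union>h\<in>H. B h))"
    using p by (simp add: emeasure_eq_measure ennreal_mult)
  then show ?thesis
    using p unfolding past past_step by (simp add: mult.commute)
qed

text \<open>
  The law of total probability with finitely many terms: the other values of \<open>Z\<close> are
  countably many, so together they still form a null set.
\<close>

lemma (in prob_space) prob_decompose_finitely_many_values:
  assumes Z: "Z \<in> measurable M (count_space E)" and E: "countable E"
    and F: "F \<in> sets M" and T: "finite T" "T \<subseteq> E"
    and null: "\<And>s. s \<in> E - T \<Longrightarrow> prob {\<omega> \<in> F. Z \<omega> = s} = 0"
  shows "prob F = (\<Sum>s\<in>T. prob {\<omega> \<in> F. Z \<omega> = s})"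
proof -
  have meas: "{\<omega> \<in> F. Z \<omega> = s} \<in> sets M" if "s \<in> E" for s
  proof -
    have "{\<omega> \<in> F. Z \<omega> = s} = F \<inter> (Z -` {s} \<inter> space M)"
      using sets.sets_into_space[OF F] by auto
    then show ?thesis using measurable_sets[OF Z, of "{s}"] that F by auto
  qed
  have null_sets: "(\<Union>s\<in>E - T. {\<omega> \<in> F. Z \<omega> = s}) \<in> null_sets M"
    using E meas null
    by (intro null_sets_UN') (auto simp: null_sets_def emeasure_eq_measure)
  have F_eq: "F = (\<Union>s\<in>T. {\<omega> \<in> F. Z \<omega> = s}) \<union> (\<Union>s\<in>E - T. {\<omega> \<in> F. Z \<omega> = s})"
    using measurable_space[OF Z] sets.sets_into_space[OF F] T by fastforce
  have T_sets: "(\<Union>s\<in>T. {\<omega> \<in> F. Z \<omega> = s}) \<in> sets M"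
    using T meas by (intro sets.finite_UN) auto
  have "prob F = prob (\<Union>s\<in>T. {\<omega> \<in> F. Z \<omega> = s})"
    by (subst F_eq) (rule measure_Un_null_set[OF T_sets null_sets])
  also have "\<dots> = (\<Sum>s\<in>T. prob {\<omega> \<in> F. Z \<omega> = s})"
    using T meas by (intro finite_measure_finite_Union) (auto simp: disjoint_family_on_def)
  finally show ?thesis .
qed

text \<open>
  The forward equation of the chain, restricted to an event \<open>Q\<close> of the past. A finite set \<open>T\<close> of
  predecessors suffices if no other state is both reachable within \<open>Q\<close> and able to jump to
  \<open>y\<close>. For the run chain such a set exists even though infinitely many states lead to
  \<open>(x, 1)\<close>: the age of a run is bounded by the number of letters seen.
\<close>

lemma markov_chain_predecessors:
  assumes chain: "markov_chain \<Omega> E p Z" and E: "y \<in> E" and p: "\<And>s. s \<in> E \<Longrightarrow> p s y \<ge> 0"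
    and T: "finite T" "T \<subseteq> E"
    and null: "\<And>s. s \<in> E - T \<Longrightarrow>
      \<P>(\<omega> in \<Omega>. Q (\<lambda>i\<in>{..n}. Z i \<omega>) \<and> Z n \<omega> = s) * p s y = 0"
  shows "\<P>(\<omega> in \<Omega>. Q (\<lambda>i\<in>{..n}. Z i \<omega>) \<and> Z (Suc n) \<omega> = y) =
         (\<Sum>s\<in>T. \<P>(\<omega> in \<Omega>. Q (\<lambda>i\<in>{..n}. Z i \<omega>) \<and> Z n \<omega> = s) * p s y)"
proof -
  interpret prob_space \<Omega>
    using chain by (simp add: markov_chain_def)
  have E_count: "countable E" and Z: "\<And>i. Z i \<in> measurable \<Omega> (count_space E)"
    using chain by (auto simp: markov_chain_def)
  define F where "F = {\<omega> \<in> space \<Omega>. Q (\<lambda>i\<in>{..n}. Z i \<omega>) \<and> Z (Suc n) \<omega> = y}"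
  have "F = ((\<lambda>\<omega>. \<lambda>i\<in>{..n}. Z i \<omega>) -` {h \<in> {..n} \<rightarrow>\<^sub>E E. Q h} \<inter> space \<Omega>) \<inter>
      (Z (Suc n) -` {y} \<inter> space \<Omega>)"
    using measurable_space[OF Z] by (auto simp: F_def)
  then have F: "F \<in> sets \<Omega>"
    using measurable_sets[OF measurable_history[OF Z E_count], of "{h \<in> {..n} \<rightarrow>\<^sub>E E. Q h}" n]
      measurable_sets[OF Z, of "{y}" "Suc n"] E by auto
  have step: "prob {\<omega> \<in> F. Z n \<omega> = s} =
      \<P>(\<omega> in \<Omega>. Q (\<lambda>i\<in>{..n}. Z i \<omega>) \<and> Z n \<omega> = s) * p s y" if "s \<in> E" for s
    using markov_chain_step[OF chain that E p[OF that], of Q n]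
    by (simp add: F_def conj_assoc)
  have "prob F = (\<Sum>s\<in>T. prob {\<omega> \<in> F. Z n \<omega> = s})"
    using null by (intro prob_decompose_finitely_many_values[OF Z E_count F T]) (auto simp: step)
  also have "\<dots> = (\<Sum>s\<in>T. \<P>(\<omega> in \<Omega>. Q (\<lambda>i\<in>{..n}. Z i \<omega>) \<and> Z n \<omega> = s) * p s y)"
    using T by (intro sum.cong) (auto simp: step)
  finally show ?thesis by (simp add: F_def)
qed


section \<open>The joint law of the number of ones and the current state\<close>

lemma L1_Suc: "L1 X (Suc n) \<omega> = L1 X n \<omega> + of_bool (X (Suc n) \<omega> = 1)"
  by (simp add: L1_def)

lemma L1_le: "L1 X n \<omega> \<le> n"
proof (induction n)
  case 0
  show ?case by (simp add: L1_def)
next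
  case (Suc n)
  then show ?case by (cases "X (Suc n) \<omega> = 1") (auto simp: L1_Suc)
qed

text \<open>
  The formula for the probability that \<open>L\<^sub>n(1) = k\<close> and the current state is \<open>(x, l)\<close>, where
  \<open>n = k + j\<close>: the current run started before the last \<open>l\<close> letters and has not ended since.
  There are \<open>k + 1\<close> letters \<open>1\<close> because \<open>X\<^sub>0 = 1\<close> is left out of \<open>L\<^sub>n(1)\<close>. The guards on \<open>l\<close>
  exclude runs longer than the number of letters available.
\<close>

definition state_weight :: "(nat \<Rightarrow> nat \<Rightarrow> real) \<Rightarrow> nat \<Rightarrow> nat \<Rightarrow> int \<times> nat \<Rightarrow> real" where
  "state_weight \<alpha> k j s = (case s of (x, l) \<Rightarrow>
     if x = 1 then (if l \<le> k + 1 then plus_run_start \<alpha> (k + 1 - l) j * surv \<alpha> 2 l else 0)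
     else (if l \<le> j then minus_run_start \<alpha> (k + 1) (j - l) * surv \<alpha> 1 l else 0))"

text \<open>
  The factor \<open>f\<close> is a transition probability in the one-step equation and the constant \<open>1\<close> in the
  final summation over the current state.
\<close>

lemma sum_state_weight_minus:
  "(\<Sum>s\<in>{-1} \<times> {1..j}. state_weight \<alpha> k j s * f s) =
     (\<Sum>l=1..j. minus_run_start \<alpha> (k + 1) (j - l) * surv \<alpha> 1 l * f (-1, l))"
  unfolding sum.cartesian_product' by (simp add: state_weight_def)

lemma sum_state_weight_plus:
  "(\<Sum>s\<in>{1} \<times> {1..k + 1}. state_weight \<alpha> k j s * f s) =
     (\<Sum>l=1..k + 1. plus_run_start \<alpha> (k + 1 - l) j * surv \<alpha> 2 l * f (1, l))"
  unfolding sum.cartesian_product'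
  by (simp add: state_weight_def del: sum.cl_ivl_Suc)

text \<open>
  Induction on \<open>n\<close>. A state \<open>(x, l + 1)\<close> with \<open>l \<ge> 1\<close> has the only predecessor \<open>(x, l)\<close>, and
  the extra factor is that of \<open>surv\<close>. A state \<open>(x, 1)\<close> has the predecessors \<open>(-x, i)\<close>, of which
  finitely many have positive probability for a given value of \<open>L\<^sub>n(1)\<close>, and the sum over \<open>i\<close> is one of the
  recursions for the start of a run. A step to \<open>1\<close> increases \<open>k\<close> and a step to \<open>-1\<close>
  increases \<open>j\<close>.
\<close>

lemma joint_law:
  fixes X :: "nat \<Rightarrow> 'w \<Rightarrow> int"
  assumes alpha: "\<And>i n. i \<in> {1, 2} \<Longrightarrow> n \<ge> 1 \<Longrightarrow> \<alpha> i n \<in> {0<..<1}"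
    and chain: "markov_chain \<Omega> states (trans_prob \<alpha>) (\<lambda>n \<omega>. (X n \<omega>, M n \<omega>))"
    and init: "\<And>\<omega>. \<omega> \<in> space \<Omega> \<Longrightarrow> (X 0 \<omega>, M 0 \<omega>) = (1, 1)"
    and "n = k + j" and "s \<in> states"
  shows "\<P>(\<omega> in \<Omega>. L1 X n \<omega> = k \<and> (X n \<omega>, M n \<omega>) = s) = state_weight \<alpha> k j s"
  using assms(4,5)
proof (induction n arbitrary: k j s)
  case 0
  interpret prob_space \<Omega>
    using chain by (simp add: markov_chain_def)
  have kj: "k = 0" "j = 0" using 0 by auto
  have "X 0 \<omega> = 1 \<and> M 0 \<omega> = 1" if "\<omega> \<in> space \<Omega>" for \<omega>
    using init[OF that] by simp
  then have event: "{\<omega> \<in> space \<Omega>. L1 X 0 \<omega> = k \<and> (X 0 \<omega>, M 0 \<omega>) = s} =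
      (if s = (1, 1) then space \<Omega> else {})"
    using kj by (auto simp: L1_def)
  show ?case
  proof (cases "s = (1, 1)")
    case True
    then show ?thesis
      unfolding event unfolding kj by (simp add: state_weight_def plus_run_start_0_0 surv_1 prob_space)
  next
    case False
    then have "state_weight \<alpha> 0 0 s = 0"
      using 0 by (cases s) (auto simp: state_weight_def states_def)
    then show ?thesis
      using False unfolding event unfolding kj by simp
  qed
next
  case (Suc n)
  obtain x l where s: "s = (x, l)" by (cases s)
  have x: "x = 1 \<or> x = -1" and l: "l \<ge> 1" using Suc.prems s by (auto simp: states_def)
  have nonneg: "trans_prob \<alpha> r s \<ge> 0" if "r \<in> states" for r
    using that alpha[of 1 "snd r"] alpha[of 2 "snd r"]
    by (cases r; cases s) (auto simp: states_def letter_index_def)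
  have pred: "\<P>(\<omega> in \<Omega>. L1 X n \<omega> = k' \<and> (X (Suc n) \<omega>, M (Suc n) \<omega>) = s) =
      (\<Sum>r\<in>T. state_weight \<alpha> k' j' r * trans_prob \<alpha> r s)"
    if k': "n = k' + j'" and T: "finite T" "T \<subseteq> states"
      and null: "\<And>r. r \<in> states - T \<Longrightarrow> state_weight \<alpha> k' j' r * trans_prob \<alpha> r s = 0"
    for k' j' T
  proof -
    \<comment> \<open>The event \<open>L\<^sub>n(1) = k'\<close>, read off from the history of the chain.\<close>
    define Q where "Q h = ((\<Sum>i=1..n. of_bool (fst (h i) = (1::int))) = k')"
      for h :: "nat \<Rightarrow> int \<times> nat"
    have Q: "Q (\<lambda>i\<in>{..n}. (X i \<omega>, M i \<omega>)) \<longleftrightarrow> L1 X n \<omega> = k'" for \<omega>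
      by (simp add: Q_def L1_def)
    have "(\<P>(\<omega> in \<Omega>. Q (\<lambda>i\<in>{..n}. (X i \<omega>, M i \<omega>)) \<and> (X (Suc n) \<omega>, M (Suc n) \<omega>) = s)) =
      (\<Sum>r\<in>T. \<P>(\<omega> in \<Omega>. Q (\<lambda>i\<in>{..n}. (X i \<omega>, M i \<omega>)) \<and> (X n \<omega>, M n \<omega>) = r)
        * trans_prob \<alpha> r s)"
    proof (rule markov_chain_predecessors[OF chain Suc.prems(2) nonneg T])
      fix r
      assume "r \<in> states - T"
      then show "\<P>(\<omega> in \<Omega>. Q (\<lambda>i\<in>{..n}. (X i \<omega>, M i \<omega>)) \<and> (X n \<omega>, M n \<omega>) = r)
          * trans_prob \<alpha> r s = 0"
        unfolding Q using Suc.IH[OF k', of r] null by simp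
    qed
    also have "\<dots> = (\<Sum>r\<in>T. state_weight \<alpha> k' j' r * trans_prob \<alpha> r s)"
      unfolding Q using Suc.IH[OF k'] T by (intro sum.cong refl) (simp only: subset_iff)
    finally show ?thesis unfolding Q .
  qed
  show ?case
  proof (cases "x = 1")
    case True
    show ?thesis
    proof (cases k)
      case 0
      have event: "{\<omega> \<in> space \<Omega>. L1 X (Suc n) \<omega> = k \<and> (X (Suc n) \<omega>, M (Suc n) \<omega>) = s} = {}"
        using 0 True s by (auto simp: L1_Suc)
      show ?thesis
        unfolding event using 0 True s l Suc.prems(1)
        by (auto simp: state_weight_def plus_run_start_0)
    next
      case (Suc k')
      have event: "{\<omega> \<in> space \<Omega>. L1 X (Suc n) \<omega> = k \<and> (X (Suc n) \<omega>, M (Suc n) \<omega>) = s} =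
          {\<omega> \<in> space \<Omega>. L1 X n \<omega> = k' \<and> (X (Suc n) \<omega>, M (Suc n) \<omega>) = s}"
        using Suc True s by (auto simp: L1_Suc)
      have n: "n = k' + j" using Suc.prems(1) Suc by simp
      show ?thesis
      proof (cases "l = 1")
        case l1: True
        have "\<P>(\<omega> in \<Omega>. L1 X n \<omega> = k' \<and> (X (Suc n) \<omega>, M (Suc n) \<omega>) = s) =
            (\<Sum>r\<in>{-1} \<times> {1..j}. state_weight \<alpha> k' j r * trans_prob \<alpha> r s)"
          by (rule pred[OF n])
            (auto simp: states_def state_weight_def s True l1 split: if_splits)
        also have "\<dots> = (\<Sum>i=1..j. minus_run_start \<alpha> k (j - i) * (surv \<alpha> 1 i * \<alpha> 1 i))"
          unfolding sum_state_weight_minus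
          by (simp add: s True l1 letter_index_def Suc mult.assoc)
        also have "\<dots> = plus_run_start \<alpha> k j"
          using Suc by (subst plus_run_start_rec) auto
        finally show ?thesis
          unfolding event using s True l1 by (simp add: state_weight_def surv_1)
      next
        case False
        then obtain l' where l': "l = Suc l'" "l' \<ge> 1" using l by (cases l) auto
        have "\<P>(\<omega> in \<Omega>. L1 X n \<omega> = k' \<and> (X (Suc n) \<omega>, M (Suc n) \<omega>) = s) =
            (\<Sum>r\<in>{(1, l')}. state_weight \<alpha> k' j r * trans_prob \<alpha> r s)"
          using l' by (intro pred[OF n]) (auto simp: states_def s True split: if_splits)
        then show ?thesis
          unfolding event using s True l' Suc
          by (simp add: state_weight_def letter_index_def surv_Suc)
      qed
    qed
  next
    case False
    with x have x: "x = -1" by simp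
    have event: "{\<omega> \<in> space \<Omega>. L1 X (Suc n) \<omega> = k \<and> (X (Suc n) \<omega>, M (Suc n) \<omega>) = s} =
        {\<omega> \<in> space \<Omega>. L1 X n \<omega> = k \<and> (X (Suc n) \<omega>, M (Suc n) \<omega>) = s}"
      using x s by (auto simp: L1_Suc)
    show ?thesis
    proof (cases j)
      case 0
      have "L1 X n \<omega> \<noteq> k" for \<omega>
        using Suc.prems(1) 0 L1_le[of X n \<omega>] by simp
      then have no_event:
        "{\<omega> \<in> space \<Omega>. L1 X n \<omega> = k \<and> (X (Suc n) \<omega>, M (Suc n) \<omega>) = s} = {}"
        by simp
      show ?thesis
        unfolding event no_event using 0 x s l by (simp add: state_weight_def)
    next
      case (Suc j')
      have n: "n = k + j'" using Suc.prems(1) Suc by simp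
      show ?thesis
      proof (cases "l = 1")
        case l1: True
        have "\<P>(\<omega> in \<Omega>. L1 X n \<omega> = k \<and> (X (Suc n) \<omega>, M (Suc n) \<omega>) = s) =
            (\<Sum>r\<in>{1} \<times> {1..k + 1}. state_weight \<alpha> k j' r * trans_prob \<alpha> r s)"
          by (rule pred[OF n])
            (auto simp: states_def state_weight_def s x l1 split: if_splits)
        also have "\<dots> = (\<Sum>i=1..k + 1. plus_run_start \<alpha> (k + 1 - i) j' * (surv \<alpha> 2 i * \<alpha> 2 i))"
          unfolding sum_state_weight_plus
          by (simp add: s x l1 letter_index_def mult.assoc del: sum.cl_ivl_Suc)
        also have "\<dots> = minus_run_start \<alpha> (k + 1) j'"
          by (rule minus_run_start_rec[symmetric])
        finally show ?thesis
          unfolding event using s x l1 Suc by (simp add: state_weight_def surv_1)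
      next
        case False
        then obtain l' where l': "l = Suc l'" "l' \<ge> 1" using l by (cases l) auto
        have "\<P>(\<omega> in \<Omega>. L1 X n \<omega> = k \<and> (X (Suc n) \<omega>, M (Suc n) \<omega>) = s) =
            (\<Sum>r\<in>{(-1, l')}. state_weight \<alpha> k j' r * trans_prob \<alpha> r s)"
          using l' by (intro pred[OF n]) (auto simp: states_def s x split: if_splits)
        then show ?thesis
          unfolding event using s x l' Suc
          by (simp add: state_weight_def letter_index_def surv_Suc)
      qed
    qed
  qed
qed


section \<open>Summing over the current state\<close>

text \<open>
  The ranges of summation in \<open>eta1\<close> contain all nonzero terms of the double sum over
  \<open>1 \<le> m \<le> n - k\<close> and \<open>1 \<le> l \<le> n - k\<close>, because \<open>A \<alpha> i m b = 0\<close> for \<open>b < m\<close>. After this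
  extension the two sums can be exchanged.
\<close>

lemma eta1_eq:
  "eta1 \<alpha> n k = (\<Sum>l=1..n - k. minus_run_start \<alpha> (k + 1) (n - k - l) * surv \<alpha> 1 l)"
proof -
  define j where "j = n - k"
  have "eta1 \<alpha> n k = (\<Sum>m=1..j.
      A \<alpha> 2 m (k + 1) * (\<Sum>l=1..j. of_bool (l \<le> j - m + 1) * (A \<alpha> 1 (m - 1) (j - l) * surv \<alpha> 1 l)))"
    unfolding eta1_def j_def[symmetric]
  proof (intro sum.mono_neutral_cong_left ballI)
    fix m assume "m \<in> {1..min (k + 1) j}"
    then show "A \<alpha> 2 m (k + 1) * (\<Sum>l=1..j - m + 1. A \<alpha> 1 (m - 1) (j - l) * surv \<alpha> 1 l) =
      A \<alpha> 2 m (k + 1) * (\<Sum>l=1..j. of_bool (l \<le> j - m + 1) * (A \<alpha> 1 (m - 1) (j - l) * surv \<alpha> 1 l))"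
      by (intro arg_cong[where f = "(*) (A \<alpha> 2 m (k + 1))"] sum.mono_neutral_cong_left)
        auto
  qed (auto simp: A_eq_0)
  also have "\<dots> = (\<Sum>m=1..j. \<Sum>l=1..j. A \<alpha> 1 (m - 1) (j - l) * A \<alpha> 2 m (k + 1) * surv \<alpha> 1 l)"
    unfolding sum_distrib_left by (intro sum.cong refl) (auto simp: A_eq_0)
  also have "\<dots> = (\<Sum>l=1..j. \<Sum>m=1..j. A \<alpha> 1 (m - 1) (j - l) * A \<alpha> 2 m (k + 1) * surv \<alpha> 1 l)"
    by (rule sum.swap)
  also have "\<dots> = (\<Sum>l=1..j. minus_run_start \<alpha> (k + 1) (j - l) * surv \<alpha> 1 l)"
  proof (rule sum.cong[OF refl])
    fix l assume l: "l \<in> {1..j}"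
    have "(\<Sum>m=1..j. A \<alpha> 1 (m - 1) (j - l) * A \<alpha> 2 m (k + 1) * surv \<alpha> 1 l) =
        (\<Sum>m<j. A \<alpha> 1 m (j - l) * A \<alpha> 2 (Suc m) (k + 1) * surv \<alpha> 1 l)"
      by (rule sum.reindex_bij_witness[of _ Suc "\<lambda>m. m - 1"]) auto
    also have "\<dots> = (\<Sum>m\<le>j - l. A \<alpha> 1 m (j - l) * A \<alpha> 2 (Suc m) (k + 1) * surv \<alpha> 1 l)"
      using l by (intro sum.mono_neutral_right) (auto simp: A_eq_0)
    finally show "(\<Sum>m=1..j. A \<alpha> 1 (m - 1) (j - l) * A \<alpha> 2 m (k + 1) * surv \<alpha> 1 l) =
        minus_run_start \<alpha> (k + 1) (j - l) * surv \<alpha> 1 l"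
      by (simp add: minus_run_start_def sum_distrib_right)
  qed
  finally show ?thesis by (simp add: j_def)
qed

text \<open>
  As for \<open>eta1\<close>, now extending to \<open>0 \<le> m \<le> n - k\<close> and \<open>1 \<le> l \<le> k + 1\<close>.
\<close>

lemma eta2_eq:
  "eta2 \<alpha> n k = (\<Sum>l=1..k + 1. plus_run_start \<alpha> (k + 1 - l) (n - k) * surv \<alpha> 2 l)"
proof -
  define j where "j = n - k"
  have "eta2 \<alpha> n k = (\<Sum>m\<le>j. \<Sum>l=1..k + 1. A \<alpha> 1 m j * A \<alpha> 2 m (k + 1 - l) * surv \<alpha> 2 l)"
    unfolding eta2_def j_def[symmetric]
  proof (intro sum.mono_neutral_cong_left ballI)
    fix m assume "m \<in> {..j} - {0..min k j}"
    then show "(\<Sum>l=1..k + 1. A \<alpha> 1 m j * A \<alpha> 2 m (k + 1 - l) * surv \<alpha> 2 l) = 0"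
      by (intro sum.neutral) (auto simp: A_eq_0)
  next
    fix m assume "m \<in> {0..min k j}"
    then show "A \<alpha> 1 m j * (\<Sum>l=1..k - m + 1. A \<alpha> 2 m (k + 1 - l) * surv \<alpha> 2 l) =
        (\<Sum>l=1..k + 1. A \<alpha> 1 m j * A \<alpha> 2 m (k + 1 - l) * surv \<alpha> 2 l)"
      unfolding sum_distrib_left mult.assoc
      by (intro sum.mono_neutral_left) (auto simp: A_eq_0)
  qed auto
  also have "\<dots> = (\<Sum>l=1..k + 1. plus_run_start \<alpha> (k + 1 - l) j * surv \<alpha> 2 l)"
    by (subst sum.swap) (simp add: plus_run_start_def sum_distrib_right)
  finally show ?thesis by (simp add: j_def)
qed

lemma prob_L1_eq:
  fixes X :: "nat \<Rightarrow> 'w \<Rightarrow> int"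
  assumes alpha: "\<And>i n. i \<in> {1, 2} \<Longrightarrow> n \<ge> 1 \<Longrightarrow> \<alpha> i n \<in> {0<..<1}"
    and chain: "markov_chain \<Omega> states (trans_prob \<alpha>) (\<lambda>n \<omega>. (X n \<omega>, M n \<omega>))"
    and init: "\<And>\<omega>. \<omega> \<in> space \<Omega> \<Longrightarrow> (X 0 \<omega>, M 0 \<omega>) = (1, 1)"
    and "k \<le> n"
  shows "\<P>(\<omega> in \<Omega>. L1 X n \<omega> = k) = eta1 \<alpha> n k + eta2 \<alpha> n k"
proof -
  interpret prob_space \<Omega>
    using chain by (simp add: markov_chain_def)
  have E: "countable states"
    and Z: "\<And>n. (\<lambda>\<omega>. (X n \<omega>, M n \<omega>)) \<in> measurable \<Omega> (count_space states)"
    using chain by (auto simp: markov_chain_def)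
  have X: "X i \<in> measurable \<Omega> (count_space UNIV)" for i
    using measurable_compose[OF Z[of i], of fst "count_space UNIV"] by simp
  define F where "F = {\<omega> \<in> space \<Omega>. L1 X n \<omega> = k}"
  have F: "F \<in> sets \<Omega>"
    unfolding F_def L1_def using X by measurable
  have joint: "prob {\<omega> \<in> F. (X n \<omega>, M n \<omega>) = s} = state_weight \<alpha> k (n - k) s"
    if "s \<in> states" for s
    using joint_law[OF alpha chain init, of n k "n - k" s] that \<open>k \<le> n\<close>
    by (simp add: F_def conj_assoc)
  define T where "T = {-1 :: int} \<times> {1..n - k} \<union> {1} \<times> {1..k + 1}"
  have T: "finite T" "T \<subseteq> states" by (auto simp: T_def states_def)
  have "prob F = (\<Sum>s\<in>T. prob {\<omega> \<in> F. (X n \<omega>, M n \<omega>) = s})"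
    by (intro prob_decompose_finitely_many_values[OF Z E F T])
      (auto simp: joint, auto simp: T_def states_def state_weight_def)
  also have "\<dots> = (\<Sum>s\<in>T. state_weight \<alpha> k (n - k) s * 1)"
    using T joint by (intro sum.cong refl) (simp only: mult_1_right, blast)
  also have "\<dots> = (\<Sum>s\<in>{-1} \<times> {1..n - k}. state_weight \<alpha> k (n - k) s * 1) +
      (\<Sum>s\<in>{1} \<times> {1..k + 1}. state_weight \<alpha> k (n - k) s * 1)"
    unfolding T_def by (rule sum.union_disjoint) auto
  also have "\<dots> = eta1 \<alpha> n k + eta2 \<alpha> n k"
    unfolding sum_state_weight_minus sum_state_weight_plus
    unfolding eta1_eq eta2_eq mult_1_right ..
  finally show ?thesis by (simp add: F_def)
qed

lemma S_eq_L1: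
  assumes "\<And>i. X i \<omega> \<in> {-1, 1}" and "X 0 \<omega> = 1"
  shows "S X n \<omega> = 1 + 2 * int (L1 X n \<omega>) - int n"
proof (induction n)
  case 0
  then show ?case using assms(2) by (simp add: S_def L1_def)
next
  case (Suc n)
  then show ?case using assms(1)[of "Suc n"] by (auto simp: S_def L1_Suc)
qed

theorem proposition4p1:
  fixes \<Omega> :: "'w measure"
    and \<alpha> :: "nat \<Rightarrow> nat \<Rightarrow> real"
    and X :: "nat \<Rightarrow> 'w \<Rightarrow> int"
    and M :: "nat \<Rightarrow> 'w \<Rightarrow> nat"
  assumes alpha: "\<And>i n. i \<in> {1, 2} \<Longrightarrow> n \<ge> 1 \<Longrightarrow> \<alpha> i n \<in> {0<..<1}"
    and chain: "markov_chain \<Omega> states (trans_prob \<alpha>) (\<lambda>n \<omega>. (X n \<omega>, M n \<omega>))"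
    and init: "\<And>\<omega>. \<omega> \<in> space \<Omega> \<Longrightarrow> (X 0 \<omega>, M 0 \<omega>) = (1, 1)"
  shows "(\<forall>n\<ge>1. \<forall>\<omega>\<in>space \<Omega>. S X n \<omega> = 1 + 2 * int (L1 X n \<omega>) - int n)
       \<and> (\<forall>n. \<forall>k\<le>n. eta \<Omega> X n k = \<P>(\<omega> in \<Omega>. L1 X n \<omega> = k))
       \<and> (\<forall>n. \<forall>k\<le>n. eta \<Omega> X n k = eta1 \<alpha> n k + eta2 \<alpha> n k)"
proof -
  have "(X n \<omega>, M n \<omega>) \<in> states" if "\<omega> \<in> space \<Omega>" for n \<omega>
    using chain that by (auto simp: markov_chain_def dest!: spec measurable_space)
  then have S_eq: "S X n \<omega> = 1 + 2 * int (L1 X n \<omega>) - int n" if "\<omega> \<in> space \<Omega>" for n \<omega>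
    using that init[OF that] by (intro S_eq_L1) (auto simp: states_def)
  have eta: "eta \<Omega> X n k = \<P>(\<omega> in \<Omega>. L1 X n \<omega> = k)" for n k
    unfolding eta_def
    by (rule arg_cong[where f = "measure \<Omega>"]) (auto simp: S_eq)
  show ?thesis
    using S_eq eta prob_L1_eq[OF alpha chain init] by simp
qed

end
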